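(* Let $s\in\mathbb{Z}_{\ge1}$ and let $\widetilde{\mathcal{T}}_m(u)$ be the normalized functions associated with $B(0|s)$ defined in the context. Then for every $m\in\{0,1,\dots,2s+1\}$, $$\widetilde{\mathcal{T}}_m(u)=\widetilde{\mathcal{T}}_{2s-m+1}(u).$$
   Context: $\Phi$ is an entire function, not identically zero, with a zero at $u=0$ (e.g. $\Phi(u)=u$); $N,N_a\in\mathbb{Z}_{\ge0}$; $w_j,u_j^{(a)}\in\mathbb{C}$ are parameters; $Q_a(u)=\prod_{j=1}^{N_a}\Phi(u-u_j^{(a)})$ for $1\le a\le s$; $Q_0(u)=1$; $\phi(u)=\prod_{j=1}^N\Phi(u-w_j)$. Identities are between meromorphic functions of $u$. **Index set.** $J=\{1,\dots,s,0,\overline s,\dots,\overline1\}$ with total order $1\prec\cdots\prec s\prec0\prec\overline s\prec\cdots\prec\overline1$; $p(0)=0$ and $p(c)=1$ for $c\ne0$. **Box functions.** - $1\le a\le s$: $[a]_u=\psi_a(u)\frac{Q_{a-1}(u-a-1)Q_a(u-a+2)}{Q_{a-1}(u-a+1)Q_a(u-a)}$. - $[0]_u=\psi_0(u)\frac{Q_s(u-s+1)Q_s(u-s-2)}{Q_s(u-s-1)Q_s(u-s)}$. - $1\le a\le s$: $[\overline a]_u=\psi_{\overline a}(u)\frac{Q_{a-1}(u-2s+a)Q_a(u-2s+a-3)}{Q_{a-1}(u-2s+a-2)Q_a(u-2s+a-1)}$. Here $\psi_1(u)=\phi(u-2)\phi(u-2s-1)$, $\psi_{\overline1}(u)=\phi(u)\phi(u-2s+1)$,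 and $\psi_c(u)=\phi(u)\phi(u-2s-1)$ for all other $c\in J$. **Row functions.** For $m\ge1$, $$\mathcal{T}_m(u)=\sum_{b_1\prec b_2\prec\cdots\prec b_m}\ \prod_{k=1}^m(-1)^{p(b_k)}[b_k]_{u-m+2k-1}\qquad(b_k\in J),$$ and $\mathcal{T}_0(u)=1$. **Normalization.** $\widetilde{\mathcal{T}}_m(u)=\mathcal{T}_m(u)/\mathcal{F}_m(u)$, where $$\mathcal{F}_m(u)=\prod_{j=1}^{m-1}\phi(u-m+2j+1)\,\phi(u-2s-m+2j-2)\quad(m\ge2),$$ $\mathcal{F}_1(u)=1$, and $\mathcal{F}_0(u)=\{\phi(u+1)\phi(u-2s-2)\}^{-1}$. *)

theory Defs
  imports "HOL-Complex_Analysis.Complex_Analysis"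
begin

(* Meromorphic functions are represented pointwise, as total functions on the complex plane
   with x / 0 = 0.  Two of them are the same meromorphic function iff they agree outside a
   closed discrete set of points, i.e. iff they agree eventually along cosparse UNIV.

   Parameters: Phi is the building block, N and w j (1 \<le> j \<le> N) define phi,
   M a and v a j (1 \<le> j \<le> M a) define Q_a; they stand for N_a and u_j^(a). *)

definition Qfun ::
  "(complex \<Rightarrow> complex) \<Rightarrow> (nat \<Rightarrow> nat) \<Rightarrow> (nat \<Rightarrow> nat \<Rightarrow> complex) \<Rightarrow> nat \<Rightarrow> complex \<Rightarrow> complex"
  where "Qfun \<Phi> M v a u = (if a = 0 then 1 else \<Prod>j=1..M a. \<Phi> (u - v a j))"

definition phi :: "(complex \<Rightarrow> complex) \<Rightarrow> nat \<Rightarrow> (nat \<Rightarrow> complex) \<Rightarrow> complex \<Rightarrow> complex"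
  where "phi \<Phi> N w u = (\<Prod>j=1..N. \<Phi> (u - w j))"

(* Pos a is the letter a, Neg a is the letter a with a bar. *)
datatype letter = Pos nat | Zero | Neg nat

definition letters :: "nat \<Rightarrow> letter set"
  where "letters s = Pos ` {1..s} \<union> {Zero} \<union> Neg ` {1..s}"

fun prec :: "letter \<Rightarrow> letter \<Rightarrow> bool" (infix "\<prec>\<^sub>J" 50)
  where
    "(Pos a \<prec>\<^sub>J Pos b) = (a < b)"
  | "(Pos a \<prec>\<^sub>J Zero) = True"
  | "(Pos a \<prec>\<^sub>J Neg b) = True"
  | "(Zero \<prec>\<^sub>J Pos b) = False"
  | "(Zero \<prec>\<^sub>J Zero) = False"
  | "(Zero \<prec>\<^sub>J Neg b) = True"
  | "(Neg a \<prec>\<^sub>J Pos b) = False"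
  | "(Neg a \<prec>\<^sub>J Zero) = False"
  | "(Neg a \<prec>\<^sub>J Neg b) = (b < a)"

definition parity :: "letter \<Rightarrow> nat"
  where "parity c = (if c = Zero then 0 else 1)"

definition psi ::
  "(complex \<Rightarrow> complex) \<Rightarrow> nat \<Rightarrow> nat \<Rightarrow> (nat \<Rightarrow> complex) \<Rightarrow> letter \<Rightarrow> complex \<Rightarrow> complex"
  where
    "psi \<Phi> s N w c u =
       (if c = Pos 1 then phi \<Phi> N w (u - 2) * phi \<Phi> N w (u - 2 * of_nat s - 1)
        else if c = Neg 1 then phi \<Phi> N w u * phi \<Phi> N w (u - 2 * of_nat s + 1)
        else phi \<Phi> N w u * phi \<Phi> N w (u - 2 * of_nat s - 1))"

fun box ::
  "(complex \<Rightarrow> complex) \<Rightarrow> nat \<Rightarrow> nat \<Rightarrow> (nat \<Rightarrow> complex) \<Rightarrow> (nat \<Rightarrow> nat) \<Rightarrow>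
   (nat \<Rightarrow> nat \<Rightarrow> complex) \<Rightarrow> letter \<Rightarrow> complex \<Rightarrow> complex"
  where
    "box \<Phi> s N w M v (Pos a) u =
       psi \<Phi> s N w (Pos a) u *
       (Qfun \<Phi> M v (a - 1) (u - of_nat a - 1) * Qfun \<Phi> M v a (u - of_nat a + 2)) /
       (Qfun \<Phi> M v (a - 1) (u - of_nat a + 1) * Qfun \<Phi> M v a (u - of_nat a))"
  | "box \<Phi> s N w M v Zero u =
       psi \<Phi> s N w Zero u *
       (Qfun \<Phi> M v s (u - of_nat s + 1) * Qfun \<Phi> M v s (u - of_nat s - 2)) /
       (Qfun \<Phi> M v s (u - of_nat s - 1) * Qfun \<Phi> M v s (u - of_nat s))"
  | "box \<Phi> s N w M v (Neg a) u =
       psi \<Phi> s N w (Neg a) u *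
       (Qfun \<Phi> M v (a - 1) (u - 2 * of_nat s + of_nat a) *
        Qfun \<Phi> M v a (u - 2 * of_nat s + of_nat a - 3)) /
       (Qfun \<Phi> M v (a - 1) (u - 2 * of_nat s + of_nat a - 2) *
        Qfun \<Phi> M v a (u - 2 * of_nat s + of_nat a - 1))"

definition rows :: "nat \<Rightarrow> nat \<Rightarrow> letter list set"
  where "rows s m = {bs. length bs = m \<and> set bs \<subseteq> letters s \<and> sorted_wrt (\<prec>\<^sub>J) bs}"

lemma finite_rows: "finite (rows s m)"
proof -
  have "rows s m \<subseteq> {bs. set bs \<subseteq> letters s \<and> length bs = m}"
    by (auto simp: rows_def)
  moreover have "finite (letters s)"
    by (simp add: letters_def)
  ultimately show ?thesis
    using finite_lists_length_eq finite_subset by blast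
qed

(* For m = 0 the only row is the empty list, so row_fun has the value 1.
   List indices start at 0, hence the k - 1. *)
definition row_fun ::
  "(complex \<Rightarrow> complex) \<Rightarrow> nat \<Rightarrow> nat \<Rightarrow> (nat \<Rightarrow> complex) \<Rightarrow> (nat \<Rightarrow> nat) \<Rightarrow>
   (nat \<Rightarrow> nat \<Rightarrow> complex) \<Rightarrow> nat \<Rightarrow> complex \<Rightarrow> complex"
  where
    "row_fun \<Phi> s N w M v m u =
       (\<Sum>bs\<in>rows s m. \<Prod>k=1..m.
          (-1) ^ parity (bs ! (k - 1)) *
          box \<Phi> s N w M v (bs ! (k - 1)) (u - of_nat m + 2 * of_nat k - 1))"

lemma row_fun_0: "row_fun \<Phi> s N w M v 0 u = 1"
proof -
  have "rows s 0 = {[]}"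
    by (auto simp: rows_def)
  thus ?thesis
    by (simp add: row_fun_def)
qed

(* For m = 1 the product is empty, so the value is 1. *)
definition norm_factor ::
  "(complex \<Rightarrow> complex) \<Rightarrow> nat \<Rightarrow> nat \<Rightarrow> (nat \<Rightarrow> complex) \<Rightarrow> nat \<Rightarrow> complex \<Rightarrow> complex"
  where
    "norm_factor \<Phi> s N w m u =
       (if m = 0 then inverse (phi \<Phi> N w (u + 1) * phi \<Phi> N w (u - 2 * of_nat s - 2))
        else \<Prod>j=1..m - 1. phi \<Phi> N w (u - of_nat m + 2 * of_nat j + 1) *
               phi \<Phi> N w (u - 2 * of_nat s - of_nat m + 2 * of_nat j - 2))"

definition normalized_row_fun ::
  "(complex \<Rightarrow> complex) \<Rightarrow> nat \<Rightarrow> nat \<Rightarrow> (nat \<Rightarrow> complex) \<Rightarrow> (nat \<Rightarrow> nat) \<Rightarrow>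
   (nat \<Rightarrow> nat \<Rightarrow> complex) \<Rightarrow> nat \<Rightarrow> complex \<Rightarrow> complex"
  where
    "normalized_row_fun \<Phi> s N w M v m u =
       row_fun \<Phi> s N w M v m u / norm_factor \<Phi> s N w m u"

lemma normalized_row_fun_meromorphic:
  assumes "\<Phi> holomorphic_on UNIV"
  shows "normalized_row_fun \<Phi> s N w M v m meromorphic_on UNIV"
proof -
  have \<Phi>: "(\<lambda>u. \<Phi> (f u)) analytic_on UNIV" if "f analytic_on UNIV" for f
  proof -
    have "\<Phi> analytic_on f ` UNIV"
      using assms analytic_on_open analytic_on_subset open_UNIV by blast
    hence "(\<Phi> \<circ> f) analytic_on UNIV"
      using that analytic_on_compose by blast
    thus ?thesis
      by (simp add: o_def)
  qed
  have Q: "(\<lambda>u. Qfun \<Phi> M v a (f u)) analytic_on UNIV"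
    if "f analytic_on UNIV" for f a
    unfolding Qfun_def by (cases "a = 0") (auto intro!: analytic_intros \<Phi> that)
  have P: "(\<lambda>u. phi \<Phi> N w (f u)) analytic_on UNIV"
    if "f analytic_on UNIV" for f
    unfolding phi_def by (auto intro!: analytic_intros \<Phi> that)
  have S: "(\<lambda>u. psi \<Phi> s N w c (f u)) analytic_on UNIV"
    if "f analytic_on UNIV" for f c
    unfolding psi_def
    by (cases "c = Pos 1"; cases "c = Neg 1") (auto intro!: analytic_intros P that)
  have B: "(\<lambda>u. box \<Phi> s N w M v c (f u)) meromorphic_on UNIV"
    if "f analytic_on UNIV" for f c
    by (cases c; simp only: box.simps;
        intro meromorphic_on_divide analytic_on_imp_meromorphic_on analytic_intros Q S that)
  have R: "row_fun \<Phi> s N w M v m meromorphic_on UNIV"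
    unfolding row_fun_def
    by (intro meromorphic_on_sum meromorphic_on_prod meromorphic_on_mult
        meromorphic_on_const B analytic_intros)
  have F: "norm_factor \<Phi> s N w m meromorphic_on UNIV"
  proof (cases "m = 0")
    case True
    thus ?thesis
      unfolding norm_factor_def
      by (simp only: simp_thms if_True)
        (intro meromorphic_on_inverse analytic_on_imp_meromorphic_on analytic_intros P)
  next
    case False
    thus ?thesis
      unfolding norm_factor_def
      by (simp only: simp_thms if_False)
        (intro analytic_on_imp_meromorphic_on analytic_intros P)
  qed
  show ?thesis
    unfolding normalized_row_fun_def by (intro meromorphic_on_divide R F)
qed

end

theory Submission
  imports Defs
begin

text \<open>
  Number the letters by \<open>1, \<dots>, n\<close> with \<open>n = 2 s + 1\<close>, put \<open>R\<^sub>a = Q\<^bsub>min a (n - a)\<^esub>\<close> for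
  \<open>0 < a < n\<close> and \<open>R\<^sub>0 = R\<^sub>n = \<phi>\<close>. Every box, including the exceptional first and last ones,
  then has the shape it has for \<open>sl(n)\<close>, with one common vacuum part \<open>\<phi>(u) \<phi>(u - n)\<close> and
  with the \<open>R\<^sub>a\<close> invariant under \<open>a \<mapsto> n - a\<close>. For a row \<open>B\<close> of length \<open>m\<close> in which \<open>r(a)\<close>
  letters are at most \<open>a\<close>, set \<open>h\<^sub>a = R\<^sub>a(y + 2) / R\<^sub>a(y)\<close> with \<open>y = u + 2 r(a) - m - a - 1\<close>;
  the row contributes the product of \<open>h\<^sub>b / h\<^bsub>b-1\<^esub>\<close> over \<open>b \<in> B\<close>. Passing to the reflected
  complement of \<open>B\<close> replaces \<open>h\<^sub>a\<close> by \<open>h\<^bsub>n-a\<^esub>\<close>, and because the product over all letters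
  telescopes to \<open>h\<^sub>n / h\<^sub>0\<close>, the two normalized contributions agree. Hence the identity holds
  summand by summand, wherever none of the finitely many values \<open>R\<^sub>a(u + k)\<close> involved vanishes.
\<close>

section \<open>Subsets of {1..n}: ranks and reflected complements\<close>

definition rank_in :: "nat set \<Rightarrow> nat \<Rightarrow> nat"
  where "rank_in B a = card (B \<inter> {..a})"

definition dual :: "nat \<Rightarrow> nat set \<Rightarrow> nat set"
  where "dual n B = (\<lambda>c. n + 1 - c) ` ({1..n} - B)"

lemma dual_subset: "dual n B \<subseteq> {1..n}"
  by (auto simp: dual_def)

lemma inj_on_reflect: "inj_on (\<lambda>c. n + 1 - c) {1..n::nat}"
  by (auto simp: inj_on_def)

lemma dual_dual:
  assumes "B \<subseteq> {1..n}"
  shows "dual n (dual n B) = B"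
proof -
  \<comment> \<open>Membership in a dual means that the reflected index is missing, so a second
    application amounts to a double negation.\<close>
  have mem: "c \<in> dual n A \<longleftrightarrow> c \<in> {1..n} \<and> n + 1 - c \<notin> A" if "A \<subseteq> {1..n}" for A c
    using that by (force simp: dual_def image_iff intro: rev_bexI[of "n + 1 - c"])
  show ?thesis
  proof (intro set_eqI)
    fix c
    show "c \<in> dual n (dual n B) \<longleftrightarrow> c \<in> B"
      using assms by (cases "c \<in> {1..n}") (auto simp: mem dual_subset subset_iff)
  qed
qed

lemma card_dual:
  assumes "B \<subseteq> {1..n}"
  shows "card (dual n B) = n - card B"
proof -
  have "card (dual n B) = card ({1..n} - B)"
    unfolding dual_def by (intro card_image inj_on_subset[OF inj_on_reflect]) auto
  also have "\<dots> = n - card B"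
    using assms by (simp add: card_Diff_subset finite_subset)
  finally show ?thesis .
qed

lemma rank_in_0: "B \<subseteq> {1..n} \<Longrightarrow> rank_in B 0 = 0"
  by (auto simp: rank_in_def card_eq_0_iff)

lemma rank_in_full: "B \<subseteq> {1..n} \<Longrightarrow> rank_in B n = card B"
  unfolding rank_in_def by (rule arg_cong[of _ _ card]) auto

lemma rank_in_le_card: "finite B \<Longrightarrow> rank_in B a \<le> card B"
  by (simp add: rank_in_def card_mono)

lemma rank_in_pred:
  assumes "finite B" "b \<in> B" "b \<ge> 1"
  shows "rank_in B b = rank_in B (b - 1) + 1"
proof -
  have "B \<inter> {..b} = insert b (B \<inter> {..b - 1})"
    using assms by auto
  thus ?thesis
    using assms by (simp add: rank_in_def)
qed

text \<open>Reflection matches the elements of the dual up to \<open>n - a\<close> with the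
  non-elements of \<open>B\<close> above \<open>a\<close>. Of the \<open>n - a\<close> indices above
  \<open>a\<close>, exactly \<open>card B - rank_in B a\<close> lie in \<open>B\<close>. Integers
  avoid truncated subtraction.\<close>

lemma rank_in_dual:
  assumes "B \<subseteq> {1..n}" "a \<le> n"
  shows "int (rank_in (dual n B) (n - a)) = int n - int a - int (card B) + int (rank_in B a)"
proof -
  have fin: "finite B"
    using assms(1) finite_subset by blast
  have "dual n B \<inter> {..n - a} = (\<lambda>c. n + 1 - c) ` ({a<..n} - B)"
    using assms(2) by (auto simp: dual_def)
  hence "rank_in (dual n B) (n - a) = card ({a<..n} - B)"
    unfolding rank_in_def
    by (simp only:) (intro card_image inj_on_subset[OF inj_on_reflect], auto)
  also have "int \<dots> = int (card {a<..n}) - int (card ({a<..n} \<inter> B))"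
    using card_Int_Diff[of "{a<..n}" B] by simp
  also have "card B = card ({a<..n} \<inter> B) + rank_in B a"
    unfolding rank_in_def using assms(1) fin
    by (subst card_Un_disjoint [symmetric]) (auto intro!: arg_cong[of _ _ card])
  ultimately show ?thesis
    using assms(2) by (simp add: of_nat_diff)
qed

lemma rank_in_nth_sorted_list:
  assumes "finite B" "i < card B"
  shows "rank_in B (sorted_list_of_set B ! i) = i + 1"
proof -
  let ?l = "sorted_list_of_set B"
  have less: "?l ! j \<le> ?l ! i \<longleftrightarrow> j \<le> i" if "j < card B" for j
    using sorted_wrt_nth_less[OF strict_sorted_list_of_set[of B], of i j]
      sorted_wrt_nth_less[OF strict_sorted_list_of_set[of B], of j i] assms that
    by (cases i j rule: linorder_cases) auto
  have "B = (\<lambda>j. ?l ! j) ` {..<card B}"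
    using assms set_conv_nth[of ?l] by (auto simp: image_def)
  hence "B \<inter> {..?l ! i} = (\<lambda>j. ?l ! j) ` {..i}"
    using less assms by fastforce
  moreover have "inj_on (\<lambda>j. ?l ! j) {..i}"
    using assms by (auto simp: inj_on_def nth_eq_iff_index_eq)
  ultimately show ?thesis
    by (simp add: rank_in_def card_image)
qed

text \<open>In increasing order the element at place \<open>k\<close> has rank \<open>k\<close>, so
  a position-dependent product along a row depends only on the underlying set.\<close>

lemma prod_sorted_list_rank:
  assumes "finite B"
  shows "(\<Prod>k=1..card B. f (sorted_list_of_set B ! (k - 1)) k) = (\<Prod>b\<in>B. f b (rank_in B b))"
proof -
  let ?l = "sorted_list_of_set B"
  have "bij_betw (\<lambda>k. ?l ! (k - 1)) {1..card B} B"
    unfolding bij_betw_def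
  proof
    show "inj_on (\<lambda>k. ?l ! (k - 1)) {1..card B}"
      by (auto simp: inj_on_def nth_eq_iff_index_eq)
    have "(\<lambda>k. ?l ! (k - 1)) ` {1..card B} = (\<lambda>j. ?l ! j) ` {..<card B}"
      by (force simp: image_iff intro: rev_bexI[of "Suc _"])
    also have "\<dots> = B"
      using assms set_conv_nth[of ?l] by (auto simp: image_def)
    finally show "(\<lambda>k. ?l ! (k - 1)) ` {1..card B} = B" .
  qed
  moreover have "rank_in B (?l ! (k - 1)) = k" if "k \<in> {1..card B}" for k
    using rank_in_nth_sorted_list[OF assms, of "k - 1"] that by auto
  hence "(\<Prod>k=1..card B. f (?l ! (k - 1)) k) =
      (\<Prod>k=1..card B. f (?l ! (k - 1)) (rank_in B (?l ! (k - 1))))"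
    by (intro prod.cong) auto
  ultimately show ?thesis
    using prod.reindex_bij_betw[of _ _ _ "\<lambda>b. f b (rank_in B b)"] by simp
qed

section \<open>Duality for the contribution of a single subset\<close>

text \<open>This is the quantity h of the overview. For \<open>a\<close> in \<open>B\<close> the
  point \<open>y\<close> is the argument of the box at position \<open>rank_in B a\<close>, lowered
  by \<open>a\<close>.\<close>

definition ratio :: "(nat \<Rightarrow> complex \<Rightarrow> complex) \<Rightarrow> nat set \<Rightarrow> complex \<Rightarrow> nat \<Rightarrow> complex"
  where "ratio R B u a =
    (let y = u + of_int (2 * int (rank_in B a) - int (card B) - int a - 1)
     in R a (y + 2) / R a y)"

text \<open>In the shift, the changes of the doubled rank, of the cardinality and of the index
  cancel, so the same function is evaluated at the same two points.\<close>

lemma ratio_dual: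
  assumes "B \<subseteq> {1..n}" "a \<le> n" "R (n - a) = R a"
  shows "ratio R (dual n B) u (n - a) = ratio R B u a"
proof -
  have "card B \<le> n"
    using card_mono[OF _ assms(1)] by simp
  hence "2 * int (rank_in (dual n B) (n - a)) - int (card (dual n B)) - int (n - a) - 1
      = 2 * int (rank_in B a) - int (card B) - int a - 1"
    using assms(2) by (simp add: rank_in_dual[OF assms(1,2)] card_dual[OF assms(1)] of_nat_diff)
  thus ?thesis
    by (simp only: ratio_def assms(3))
qed

lemma prod_ratio_telescope:
  fixes h :: "nat \<Rightarrow> complex"
  assumes "\<And>a. a \<le> n \<Longrightarrow> h a \<noteq> 0"
  shows "(\<Prod>a=1..n. h a / h (a - 1)) = h n / h 0"
  using assms by (induction n) auto

text \<open>Reflection interchanges the ratios at \<open>c\<close> and \<open>c - 1\<close>, so the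
  factor of the dual at \<open>n + 1 - c\<close> is the inverse of the factor of \<open>B\<close> at
  \<open>c\<close>. The dual product is thus the inverse of the product over the complement of
  \<open>B\<close>, and the product over all indices telescopes. The conditions on
  \<open>\<sigma>\<close> let the signs of the letters follow the same pattern.\<close>

lemma prod_dual:
  fixes R :: "nat \<Rightarrow> complex \<Rightarrow> complex" and \<sigma> :: "nat \<Rightarrow> complex"
  assumes B: "B \<subseteq> {1..n}"
    and R: "\<And>a. a \<le> n \<Longrightarrow> R (n - a) = R a"
    and nz: "\<And>a. a \<le> n \<Longrightarrow> ratio R B u a \<noteq> 0"
    and \<sigma>: "\<And>a. a \<in> {1..n} \<Longrightarrow> \<sigma> (n + 1 - a) * \<sigma> a = 1"
    and prod_\<sigma>: "(\<Prod>a=1..n. \<sigma> a) = 1"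
  shows "(\<Prod>b\<in>B. \<sigma> b * (ratio R B u b / ratio R B u (b - 1))) =
    ratio R B u n / ratio R B u 0 *
    (\<Prod>b\<in>dual n B. \<sigma> b * (ratio R (dual n B) u b / ratio R (dual n B) u (b - 1)))"
proof -
  define t where "t b = \<sigma> b * (ratio R B u b / ratio R B u (b - 1))" for b
  have t: "t b \<noteq> 0" if "b \<in> {1..n}" for b
  proof -
    have "\<sigma> b \<noteq> 0"
      using \<sigma>[OF that] by auto
    moreover have "ratio R B u b \<noteq> 0" "ratio R B u (b - 1) \<noteq> 0"
      using that by (auto intro!: nz)
    ultimately show ?thesis
      by (simp add: t_def)
  qed
  have "(\<Prod>b\<in>dual n B. \<sigma> b * (ratio R (dual n B) u b / ratio R (dual n B) u (b - 1)))
      = (\<Prod>c\<in>{1..n} - B. \<sigma> (n + 1 - c) *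
          (ratio R (dual n B) u (n + 1 - c) / ratio R (dual n B) u (n + 1 - c - 1)))"
    unfolding dual_def
    by (subst prod.reindex) (use inj_on_subset[OF inj_on_reflect] in auto)
  also have "\<dots> = (\<Prod>c\<in>{1..n} - B. inverse (t c))"
  proof (intro prod.cong refl)
    fix c assume "c \<in> {1..n} - B"
    hence c: "c \<in> {1..n}" by simp
    \<comment> \<open>This brings both indices into the form \<open>n - a\<close> required by
      \<open>ratio_dual\<close>, with \<open>a = c - 1\<close> and \<open>a = c\<close>.\<close>
    have e: "n + 1 - c = n - (c - 1)" "n + 1 - c - 1 = n - c"
      using c by auto
    have "ratio R (dual n B) u (n + 1 - c) = ratio R B u (c - 1)"
      unfolding e(1) using c by (intro ratio_dual B R) auto
    moreover have "ratio R (dual n B) u (n + 1 - c - 1) = ratio R B u c"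
      unfolding e(2) using c by (intro ratio_dual B R) auto
    moreover have "\<sigma> (n + 1 - c) = inverse (\<sigma> c)"
      using \<sigma>[OF c] by (metis inverse_unique mult.commute)
    ultimately show "\<sigma> (n + 1 - c) *
          (ratio R (dual n B) u (n + 1 - c) / ratio R (dual n B) u (n + 1 - c - 1)) = inverse (t c)"
      by (simp add: t_def divide_inverse mult_ac)
  qed
  also have "\<dots> = inverse (\<Prod>c\<in>{1..n} - B. t c)"
    by (simp add: prod_inversef[symmetric] o_def)
  finally have D: "(\<Prod>b\<in>dual n B. \<sigma> b * (ratio R (dual n B) u b / ratio R (dual n B) u (b - 1)))
      = inverse (\<Prod>c\<in>{1..n} - B. t c)" .
  have "(\<Prod>c\<in>{1..n} - B. t c) * (\<Prod>b\<in>B. t b) = (\<Prod>b=1..n. t b)"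
    using prod.subset_diff[OF B, of t] by simp
  also have "\<dots> = ratio R B u n / ratio R B u 0"
    unfolding t_def prod.distrib prod_\<sigma> using prod_ratio_telescope[OF nz] by simp
  finally have "(\<Prod>c\<in>{1..n} - B. t c) * (\<Prod>b\<in>B. t b) = ratio R B u n / ratio R B u 0" .
  moreover have "(\<Prod>c\<in>{1..n} - B. t c) \<noteq> 0"
    using t by simp
  ultimately show ?thesis
    unfolding D t_def[symmetric] divide_inverse[of _ "prod t _", symmetric]
    by (metis nonzero_eq_divide_eq mult.commute)
qed

section \<open>Rows of letters as subsets of {1..2s+1}\<close>

text \<open>On \<open>{1..2 * s + 1}\<close> this is the order isomorphism onto the alphabet. Barred
  letters are numbered backwards, so reflection exchanges \<open>Pos a\<close> with
  \<open>Neg a\<close> and fixes \<open>Zero\<close>.\<close>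

definition letter_of :: "nat \<Rightarrow> nat \<Rightarrow> letter"
  where "letter_of s b =
    (if b \<le> s then Pos b else if b = s + 1 then Zero else Neg (2 * s + 2 - b))"

fun index_of :: "nat \<Rightarrow> letter \<Rightarrow> nat"
  where
    "index_of s (Pos a) = a"
  | "index_of s Zero = s + 1"
  | "index_of s (Neg a) = 2 * s + 2 - a"

lemma index_letter_of: "b \<in> {1..2 * s + 1} \<Longrightarrow> index_of s (letter_of s b) = b"
  by (auto simp: letter_of_def)

lemma letter_index_of: "c \<in> letters s \<Longrightarrow> letter_of s (index_of s c) = c"
  by (auto simp: letters_def letter_of_def)

lemma letter_of_in_letters: "b \<in> {1..2 * s + 1} \<Longrightarrow> letter_of s b \<in> letters s"
  by (auto simp: letters_def letter_of_def intro!: image_eqI[where f = Neg])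

lemma index_of_range: "c \<in> letters s \<Longrightarrow> index_of s c \<in> {1..2 * s + 1}"
  by (auto simp: letters_def)

lemma prec_iff_index_of:
  "c \<in> letters s \<Longrightarrow> d \<in> letters s \<Longrightarrow> c \<prec>\<^sub>J d \<longleftrightarrow> index_of s c < index_of s d"
  by (auto simp: letters_def)

text \<open>A strictly increasing row is the sorted list of its set of letters, and the position of
  a letter is its rank there.\<close>

lemma sum_rows:
  "(\<Sum>bs\<in>rows s m. \<Prod>k=1..m. f (bs ! (k - 1)) k) =
   (\<Sum>B | B \<subseteq> {1..2 * s + 1} \<and> card B = m. \<Prod>b\<in>B. f (letter_of s b) (rank_in B b))"
proof (rule sum.reindex_bij_witness[where
      i = "\<lambda>B. map (letter_of s) (sorted_list_of_set B)" and
      j = "\<lambda>bs. set (map (index_of s) bs)"])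
  fix bs assume "bs \<in> rows s m"
  hence bs: "length bs = m" "set bs \<subseteq> letters s" "sorted_wrt (\<prec>\<^sub>J) bs"
    by (auto simp: rows_def)
  let ?l = "map (index_of s) bs"
  have "sorted_wrt (\<lambda>c d. index_of s c < index_of s d) bs"
    by (rule sorted_wrt_mono_rel[OF _ bs(3)]) (use bs(2) prec_iff_index_of in blast)
  hence "sorted_wrt (<) ?l"
    by (simp add: sorted_wrt_map)
  hence l: "sorted ?l" "distinct ?l"
    by (auto simp: strict_sorted_iff)
  have sl: "sorted_list_of_set (set ?l) = ?l"
    using l sorted_list_of_set.idem_if_sorted_distinct by blast
  have unindex: "map (letter_of s) ?l = bs"
    unfolding map_map by (rule map_idI) (use bs(2) letter_index_of in auto)
  show "map (letter_of s) (sorted_list_of_set (set ?l)) = bs"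
    unfolding sl unindex ..
  have card: "card (set ?l) = m"
    using l(2) bs(1) distinct_card by fastforce
  have "set ?l \<subseteq> {1..2 * s + 1}"
    using bs(2) index_of_range by fastforce
  thus "set ?l \<in> {B. B \<subseteq> {1..2 * s + 1} \<and> card B = m}"
    using card by simp
  have "(\<Prod>b\<in>set ?l. f (letter_of s b) (rank_in (set ?l) b)) =
      (\<Prod>k=1..m. f (letter_of s (?l ! (k - 1))) k)"
    using prod_sorted_list_rank[of "set ?l" "\<lambda>b. f (letter_of s b)"] unfolding card sl by simp
  also have "\<dots> = (\<Prod>k=1..m. f (bs ! (k - 1)) k)"
  proof (intro prod.cong refl)
    fix k assume "k \<in> {1..m}"
    hence "k - 1 < length ?l"
      using bs(1) by auto
    hence "letter_of s (?l ! (k - 1)) = bs ! (k - 1)"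
      using unindex nth_map by metis
    thus "f (letter_of s (?l ! (k - 1))) k = f (bs ! (k - 1)) k"
      by simp
  qed
  finally show "(\<Prod>b\<in>set ?l. f (letter_of s b) (rank_in (set ?l) b)) =
      (\<Prod>k=1..m. f (bs ! (k - 1)) k)" .
next
  fix B assume "B \<in> {B. B \<subseteq> {1..2 * s + 1} \<and> card B = m}"
  hence B: "B \<subseteq> {1..2 * s + 1}" "card B = m" and fin: "finite B"
    using finite_subset by auto
  let ?l = "sorted_list_of_set B"
  have unindex: "map (index_of s) (map (letter_of s) ?l) = ?l"
    unfolding map_map by (rule map_idI) (use B fin index_letter_of in auto)
  show "set (map (index_of s) (map (letter_of s) ?l)) = B"
    unfolding unindex using fin by simp
  have "sorted_wrt (\<lambda>b c. letter_of s b \<prec>\<^sub>J letter_of s c) ?l"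
  proof (rule sorted_wrt_mono_rel[OF _ strict_sorted_list_of_set])
    fix b c assume "b \<in> set ?l" "c \<in> set ?l" "b < c"
    hence "b \<in> {1..2 * s + 1}" "c \<in> {1..2 * s + 1}"
      using B fin by auto
    thus "letter_of s b \<prec>\<^sub>J letter_of s c"
      using \<open>b < c\<close> by (simp add: prec_iff_index_of[of _ s] letter_of_in_letters index_letter_of)
  qed
  thus "map (letter_of s) ?l \<in> rows s m"
    using B fin letter_of_in_letters by (auto simp: rows_def sorted_wrt_map)
qed

section \<open>Uniform shape of the boxes\<close>

text \<open>
  The boundary value \<open>\<phi>\<close> at \<open>a = 0\<close> and \<open>a = 2 s + 1\<close> absorbs the exceptional vacuum parts
  \<open>\<psi>\<close> of the first and the last letter.
\<close>

definition ext_Q ::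
  "(complex \<Rightarrow> complex) \<Rightarrow> nat \<Rightarrow> nat \<Rightarrow> (nat \<Rightarrow> complex) \<Rightarrow> (nat \<Rightarrow> nat) \<Rightarrow>
   (nat \<Rightarrow> nat \<Rightarrow> complex) \<Rightarrow> nat \<Rightarrow> complex \<Rightarrow> complex"
  where "ext_Q \<Phi> s N w M v a =
    (if a = 0 \<or> a = 2 * s + 1 then phi \<Phi> N w else Qfun \<Phi> M v (min a (2 * s + 1 - a)))"

lemma ext_Q_reflect:
  "a \<le> 2 * s + 1 \<Longrightarrow> ext_Q \<Phi> s N w M v (2 * s + 1 - a) = ext_Q \<Phi> s N w M v a"
  by (auto simp: ext_Q_def min.commute)

text \<open>At the first letter \<open>R 0\<close> cancels \<open>phi \<Phi> N w x\<close>, at the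
  last letter \<open>R (2 * s + 1)\<close> cancels
  \<open>phi \<Phi> N w (x - 2 * of_nat s - 1)\<close>; the two nonvanishing conditions justify
  these cancellations. The other letters only require rearranging quotients.\<close>

lemma box_letter_of:
  fixes \<Phi> s N w M v
  defines "R \<equiv> ext_Q \<Phi> s N w M v"
  assumes s: "s \<ge> 1" and b: "b \<in> {1..2 * s + 1}"
    and nz: "phi \<Phi> N w x \<noteq> 0" "phi \<Phi> N w (x - 2 * of_nat s - 1) \<noteq> 0"
  shows "box \<Phi> s N w M v (letter_of s b) x =
    phi \<Phi> N w x * phi \<Phi> N w (x - 2 * of_nat s - 1) *
    ((R b (x - of_nat b + 2) / R b (x - of_nat b)) /
     (R (b - 1) (x - of_nat b + 1) / R (b - 1) (x - of_nat b - 1)))"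
proof -
  have Q0: "Qfun \<Phi> M v 0 y = 1" for y
    by (simp add: Qfun_def)
  consider "b = 1" | "2 \<le> b" "b \<le> s" | "b = s + 1" | "s + 1 < b" "b \<le> 2 * s" | "b = 2 * s + 1"
    using b by force
  thus ?thesis
  proof cases
    case 1
    hence "R b = Qfun \<Phi> M v 1" "R (b - 1) = phi \<Phi> N w"
      using s by (auto simp: R_def ext_Q_def min_def)
    thus ?thesis
      using s 1 nz by (simp add: letter_of_def psi_def Q0 divide_simps)
  next
    case 2
    hence "R b = Qfun \<Phi> M v b" "R (b - 1) = Qfun \<Phi> M v (b - 1)"
      by (auto simp: R_def ext_Q_def min_def)
    thus ?thesis
      using 2 by (simp add: letter_of_def psi_def divide_simps)
  next
    case 3
    hence "R b = Qfun \<Phi> M v s" "R (b - 1) = Qfun \<Phi> M v s"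
      using s by (auto simp: R_def ext_Q_def min_def)
    thus ?thesis
      using 3 s by (simp add: letter_of_def psi_def divide_simps algebra_simps)
  next
    case 4
    \<comment> \<open>The letter is \<open>Neg a\<close>. Beyond the middle the indices run down, so
      \<open>R b\<close> and \<open>R (b - 1)\<close> are the functions Q at \<open>a - 1\<close>
      and \<open>a\<close>, in this order.\<close>
    define a where "a = 2 * s + 2 - b"
    have a: "b = 2 * s + 2 - a" "a \<ge> 2" "a \<le> s"
      using 4 by (auto simp: a_def)
    have "R b = Qfun \<Phi> M v (a - 1)" "R (b - 1) = Qfun \<Phi> M v a"
      using a by (auto simp: R_def ext_Q_def min_def Suc_diff_Suc numeral_2_eq_2)
    moreover have "letter_of s b = Neg a"
      using 4 by (simp add: letter_of_def a_def)
    moreover have "of_nat b = (2 * of_nat s + 2 - of_nat a :: complex)"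
      using a by (simp add: of_nat_diff)
    ultimately show ?thesis
      using a by (simp add: psi_def divide_simps algebra_simps)
  next
    case 5
    hence "R b = phi \<Phi> N w" "R (b - 1) = Qfun \<Phi> M v 1"
      using s by (auto simp: R_def ext_Q_def min_def)
    moreover have "letter_of s b = Neg 1"
      using 5 s by (simp add: letter_of_def)
    ultimately show ?thesis
      using 5 nz by (simp add: psi_def Q0 divide_simps algebra_simps)
  qed
qed

section \<open>Nonvanishing outside a closed discrete set\<close>

text \<open>A meromorphic function on a connected domain either avoids zero or equals zero outside a
  closed discrete set. Continuity at \<open>z - c\<close>, where the value is
  \<open>\<Phi> z\<close>, excludes the latter.\<close>

lemma entire_shift_nonzero_cosparse:
  fixes \<Phi> :: "complex \<Rightarrow> complex"
  assumes "\<Phi> holomorphic_on UNIV" "\<Phi> z \<noteq> 0"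
  shows "\<forall>\<^sub>\<approx>u\<in>UNIV. \<Phi> (u + c) \<noteq> 0"
proof -
  let ?f = "\<lambda>u. \<Phi> (u + c)"
  have hol: "?f holomorphic_on UNIV"
    by (rule holomorphic_on_compose_gen[OF _ assms(1), unfolded o_def])
       (auto intro!: holomorphic_intros)
  hence "(\<forall>\<^sub>\<approx>u\<in>UNIV. ?f u = 0) \<or> (\<forall>\<^sub>\<approx>u\<in>UNIV. ?f u \<noteq> 0)"
    by (intro meromorphic_imp_constant_or_avoid analytic_on_imp_meromorphic_on)
       (auto simp: analytic_on_open)
  moreover have False if "\<forall>\<^sub>\<approx>u\<in>UNIV. ?f u = 0"
  proof -
    have "eventually (\<lambda>u. ?f u = 0) (at (z - c))"
      using that by (rule eventually_cosparse_imp_eventually_at) auto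
    moreover have "isCont ?f (z - c)"
      using hol holomorphic_on_imp_continuous_on continuous_on_eq_continuous_at open_UNIV by blast
    hence "eventually (\<lambda>u. ?f u \<noteq> 0) (at (z - c))"
      unfolding isCont_def using assms(2)
      by (intro tendsto_imp_eventually_ne[of _ "\<Phi> z"]) auto
    ultimately have "eventually (\<lambda>_. False) (at (z - c))"
      by eventually_elim simp
    thus False
      by simp
  qed
  ultimately show ?thesis
    by blast
qed

section \<open>Normalization and the sum over subsets\<close>

text \<open>Pairing the second factor at \<open>j\<close> with the first factor at
  \<open>j + 1\<close> gives the normalization and leaves over one factor at each end. For
  \<open>m = 0\<close> the inverse in \<open>norm_factor\<close> cancels these two end
  factors.\<close>

lemma prod_phi_norm_factor:
  assumes "phi \<Phi> N w (u + 1) \<noteq> 0" "phi \<Phi> N w (u - 2 * of_nat s - 2) \<noteq> 0"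
  shows "(\<Prod>k=1..m. phi \<Phi> N w (u - of_nat m + 2 * of_nat k - 1) *
            phi \<Phi> N w (u - of_nat m + 2 * of_nat k - 1 - 2 * of_nat s - 1)) =
    phi \<Phi> N w (u - of_nat m + 1) * phi \<Phi> N w (u + of_nat m - 2 * of_nat s - 2) *
    norm_factor \<Phi> s N w m u"
proof (cases m)
  case 0
  thus ?thesis
    using assms by (simp add: norm_factor_def divide_simps)
next
  case (Suc p)
  have shift: "(\<Prod>k=1..Suc p. A k * C k) = A 1 * C (Suc p) * (\<Prod>j=1..p. A (Suc j) * C j)"
    for A C :: "nat \<Rightarrow> complex" and p
    by (induction p) auto
  show ?thesis
    unfolding Suc norm_factor_def shift by (simp add: algebra_simps)
qed

text \<open>The vacuum parts multiply to the same product for every row, and dividing by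
  \<open>norm_factor\<close> leaves its two end factors. The bound \<open>8 * int s + 8\<close>
  generously covers every integer shift of \<open>u\<close> that occurs.\<close>

lemma normalized_row_fun_eq:
  fixes \<Phi> s N w M v
  defines "R \<equiv> ext_Q \<Phi> s N w M v"
  assumes s: "s \<ge> 1" and m: "m \<le> 2 * s + 1"
    and nz: "\<And>a k. a \<le> 2 * s + 1 \<Longrightarrow> \<bar>k\<bar> \<le> 8 * int s + 8 \<Longrightarrow> R a (u + of_int k) \<noteq> 0"
  shows "normalized_row_fun \<Phi> s N w M v m u =
    phi \<Phi> N w (u - of_nat m + 1) * phi \<Phi> N w (u + of_nat m - 2 * of_nat s - 2) *
    (\<Sum>B | B \<subseteq> {1..2 * s + 1} \<and> card B = m.
       \<Prod>b\<in>B. (-1) ^ parity (letter_of s b) * (ratio R B u b / ratio R B u (b - 1)))"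
    (is "_ = _ * ?S")
proof -
  have phi_nz: "phi \<Phi> N w (u + of_int k) \<noteq> 0" if "\<bar>k\<bar> \<le> 8 * int s + 8" for k
    using nz[of 0 k] that by (simp add: R_def ext_Q_def)
  define x where "x k = u - of_nat m + 2 * of_nat k - 1" for k :: nat
  define g where "g k = phi \<Phi> N w (x k) * phi \<Phi> N w (x k - 2 * of_nat s - 1)" for k
  have summand: "(\<Prod>b\<in>B. (-1) ^ parity (letter_of s b) *
        box \<Phi> s N w M v (letter_of s b) (x (rank_in B b))) =
      (\<Prod>k=1..m. g k) *
      (\<Prod>b\<in>B. (-1) ^ parity (letter_of s b) * (ratio R B u b / ratio R B u (b - 1)))"
    if B: "B \<subseteq> {1..2 * s + 1}" "card B = m" for B
  proof -
    have fin: "finite B"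
      using B(1) finite_subset by blast
    have "box \<Phi> s N w M v (letter_of s b) (x (rank_in B b)) =
        g (rank_in B b) * (ratio R B u b / ratio R B u (b - 1))" if "b \<in> B" for b
    proof -
      have b: "b \<in> {1..2 * s + 1}"
        using B that by auto
      have r: "rank_in B b = rank_in B (b - 1) + 1" "rank_in B b \<le> m"
        using rank_in_pred[OF fin that] rank_in_le_card[OF fin, of b] B b by auto
      let ?k = "2 * int (rank_in B b) - int m - 1"
      have x_eq: "x (rank_in B b) = u + of_int ?k"
        "x (rank_in B b) - 2 * of_nat s - 1 = u + of_int (?k - 2 * int s - 1)"
        by (simp_all add: x_def)
      have "ratio R B u b =
          R b (x (rank_in B b) - of_nat b + 2) / R b (x (rank_in B b) - of_nat b)"
        unfolding ratio_def Let_def x_def B(2) by (simp add: algebra_simps)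
      \<comment> \<open>Since \<open>b\<close> lies in \<open>B\<close>, the rank drops by one at
        \<open>b - 1\<close>; this lowers the evaluation point by one in total, as the denominator
        in \<open>box_letter_of\<close> requires.\<close>
      moreover have "ratio R B u (b - 1) =
          R (b - 1) (x (rank_in B b) - of_nat b + 1) / R (b - 1) (x (rank_in B b) - of_nat b - 1)"
        unfolding ratio_def Let_def x_def B(2) r(1) using b
        by (simp add: of_nat_diff algebra_simps)
      moreover have "phi \<Phi> N w (x (rank_in B b)) \<noteq> 0"
        unfolding x_eq(1) by (rule phi_nz) (use r m in auto)
      moreover have "phi \<Phi> N w (x (rank_in B b) - 2 * of_nat s - 1) \<noteq> 0"
        unfolding x_eq(2) by (rule phi_nz) (use r m in auto)
      ultimately show ?thesis
        unfolding R_def g_def by (subst box_letter_of[OF s b]) auto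
    qed
    hence "(\<Prod>b\<in>B. (-1) ^ parity (letter_of s b) *
          box \<Phi> s N w M v (letter_of s b) (x (rank_in B b))) =
        (\<Prod>b\<in>B. g (rank_in B b) *
          ((-1) ^ parity (letter_of s b) * (ratio R B u b / ratio R B u (b - 1))))"
      by (intro prod.cong) auto
    \<comment> \<open>The vacuum part depends on the letter only through its rank, and the ranks run
      through 1 to \<open>m\<close>.\<close>
    also have "(\<Prod>b\<in>B. g (rank_in B b)) = (\<Prod>k=1..m. g k)"
      using prod_sorted_list_rank[OF fin, of "\<lambda>_. g"] B(2) by simp
    ultimately show ?thesis
      by (simp only: prod.distrib)
  qed
  have "row_fun \<Phi> s N w M v m u = (\<Sum>B | B \<subseteq> {1..2 * s + 1} \<and> card B = m.
      \<Prod>b\<in>B. (-1) ^ parity (letter_of s b) *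
        box \<Phi> s N w M v (letter_of s b) (x (rank_in B b)))"
    unfolding row_fun_def x_def
    by (rule sum_rows[of "\<lambda>c k. (-1) ^ parity c *
          box \<Phi> s N w M v c (u - of_nat m + 2 * of_nat k - 1)"])
  also have "\<dots> = (\<Prod>k=1..m. g k) * ?S"
    unfolding sum_distrib_left by (intro sum.cong refl summand) auto
  also have "(\<Prod>k=1..m. g k) = phi \<Phi> N w (u - of_nat m + 1) *
      phi \<Phi> N w (u + of_nat m - 2 * of_nat s - 2) * norm_factor \<Phi> s N w m u"
    unfolding g_def x_def
    using phi_nz[of 1] phi_nz[of "- 2 * int s - 2"]
    by (intro prod_phi_norm_factor) (auto simp: algebra_simps)
  finally have "row_fun \<Phi> s N w M v m u = phi \<Phi> N w (u - of_nat m + 1) *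
      phi \<Phi> N w (u + of_nat m - 2 * of_nat s - 2) * norm_factor \<Phi> s N w m u * ?S" .
  moreover have "norm_factor \<Phi> s N w m u \<noteq> 0"
  proof -
    have "phi \<Phi> N w (u - of_nat m + 2 * of_nat j + 1) \<noteq> 0"
      "phi \<Phi> N w (u - 2 * of_nat s - of_nat m + 2 * of_nat j - 2) \<noteq> 0" if "j \<le> m" for j
      using phi_nz[of "- int m + 2 * int j + 1"]
        phi_nz[of "- 2 * int s - int m + 2 * int j - 2"] that m
      by (auto simp: algebra_simps)
    thus ?thesis
      using phi_nz[of 1] phi_nz[of "- 2 * int s - 2"]
      by (auto simp: norm_factor_def algebra_simps)
  qed
  ultimately show ?thesis
    by (simp add: normalized_row_fun_def)
qed

text \<open>The involution \<open>dual\<close> matches subsets of size \<open>m\<close> with those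
  of size \<open>n - m\<close>, and the boundary quotient in \<open>prod_dual\<close> turns the end
  factors for \<open>m\<close> into those for \<open>n - m\<close>.\<close>

lemma normalized_row_fun_duality:
  fixes \<Phi> s N w M v
  defines "R \<equiv> ext_Q \<Phi> s N w M v"
  assumes s: "s \<ge> 1" and m: "m \<le> 2 * s + 1"
    and nz: "\<And>a k. a \<le> 2 * s + 1 \<Longrightarrow> \<bar>k\<bar> \<le> 8 * int s + 8 \<Longrightarrow> R a (u + of_int k) \<noteq> 0"
  shows "normalized_row_fun \<Phi> s N w M v m u =
    normalized_row_fun \<Phi> s N w M v (2 * s + 1 - m) u"
proof -
  define n where "n = 2 * s + 1"
  define \<sigma> :: "nat \<Rightarrow> complex" where "\<sigma> b = (-1) ^ parity (letter_of s b)" for b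
  define t where "t B = (\<Prod>b\<in>B. \<sigma> b * (ratio R B u b / ratio R B u (b - 1)))" for B
  \<comment> \<open>The central index \<open>s + 1\<close> is fixed by reflection, and the other
    \<open>2 * s\<close> signs are -1, an even number of them.\<close>
  have \<sigma>_eq: "\<sigma> b = (if b = s + 1 then 1 else -1)" for b
    by (auto simp: \<sigma>_def letter_of_def parity_def)
  have prod_\<sigma>: "(\<Prod>a=1..n. \<sigma> a) = 1"
  proof -
    have "{1..n} = insert (s + 1) ({1..n} - {s + 1})"
      by (auto simp: n_def)
    also have "(\<Prod>a\<in>\<dots>. \<sigma> a) = (\<Prod>a\<in>{1..n} - {s + 1}. -1)"
      by (subst prod.insert) (auto simp: \<sigma>_eq intro!: prod.cong)
    also have "\<dots> = 1"
      by (simp add: n_def)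
    finally show ?thesis .
  qed
  define P where "P k = phi \<Phi> N w (u + of_int k)" for k
  have P_nz: "P k \<noteq> 0" if "\<bar>k\<bar> \<le> 8 * int s + 8" for k
    using nz[of 0 k] that by (simp add: R_def ext_Q_def P_def)
  have R0: "R 0 = phi \<Phi> N w" "R n = phi \<Phi> N w"
    by (auto simp: R_def ext_Q_def n_def)
  have swap: "P (1 - int m) * P (int m - int n - 1) * t B =
      P (int m - int n + 1) * P (- int m - 1) * t (dual n B)"
    if B: "B \<subseteq> {1..n}" "card B = m" for B
  proof -
    have fin: "finite B"
      using B(1) finite_subset by blast
    have "ratio R B u a \<noteq> 0" if a: "a \<le> n" for a
    proof -
      let ?k = "2 * int (rank_in B a) - int m - int a - 1"
      have "\<bar>?k\<bar> \<le> 8 * int s + 8" "\<bar>?k + 2\<bar> \<le> 8 * int s + 8"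
        using rank_in_le_card[OF fin, of a] B(2) m a by (auto simp: n_def)
      hence "R a (u + of_int ?k) \<noteq> 0" "R a (u + of_int (?k + 2)) \<noteq> 0"
        using a nz by (auto simp: n_def simp del: of_int_add of_int_diff)
      thus ?thesis
        unfolding ratio_def Let_def B(2) by (simp add: add_ac)
    qed
    moreover have "R (n - a) = R a" if "a \<le> n" for a
      using that unfolding R_def n_def by (rule ext_Q_reflect)
    moreover have "\<sigma> (n + 1 - a) * \<sigma> a = 1" if "a \<in> {1..n}" for a
      using that by (auto simp: \<sigma>_eq n_def)
    ultimately have "t B = ratio R B u n / ratio R B u 0 * t (dual n B)"
      unfolding t_def by (intro prod_dual B(1) prod_\<sigma>) auto
    \<comment> \<open>At \<open>n\<close> and \<open>0\<close> the rank is \<open>m\<close> and 0,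
      so the boundary quotient is the same for all \<open>B\<close> of size
      \<open>m\<close>.\<close>
    also have "ratio R B u n = P (int m - int n + 1) / P (int m - int n - 1)"
      unfolding ratio_def Let_def R0 rank_in_full[OF B(1)] B(2) P_def by (simp add: algebra_simps)
    also have "ratio R B u 0 = P (1 - int m) / P (- int m - 1)"
      unfolding ratio_def Let_def R0 rank_in_0[OF B(1)] B(2) P_def by (simp add: algebra_simps)
    finally show ?thesis
      using P_nz[of "1 - int m"] P_nz[of "int m - int n - 1"] m
      by (simp add: n_def)
  qed
  have eq: "normalized_row_fun \<Phi> s N w M v l u =
      P (1 - int l) * P (int l - int n - 1) * (\<Sum>B | B \<subseteq> {1..n} \<and> card B = l. t B)"
    if "l \<le> n" for l
    using normalized_row_fun_eq[of s l \<Phi> N w M v u] s that nz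
    by (simp add: R_def P_def t_def \<sigma>_def n_def algebra_simps)
  have "normalized_row_fun \<Phi> s N w M v m u =
      (\<Sum>B | B \<subseteq> {1..n} \<and> card B = m. P (int m - int n + 1) * P (- int m - 1) * t (dual n B))"
    using m eq[of m] swap by (simp add: n_def sum_distrib_left)
  also have "\<dots> = (\<Sum>B | B \<subseteq> {1..n} \<and> card B = n - m.
      P (int m - int n + 1) * P (- int m - 1) * t B)"
    by (rule sum.reindex_bij_witness[of _ "dual n" "dual n"])
       (use m dual_subset in \<open>auto simp: dual_dual card_dual n_def\<close>)
  also have "\<dots> = normalized_row_fun \<Phi> s N w M v (n - m) u"
    using m eq[of "n - m"] by (simp add: n_def sum_distrib_left of_nat_diff algebra_simps)
  finally show ?thesis
    by (simp add: n_def)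
qed

section \<open>From pointwise duality to meromorphic functions\<close>

theorem theorem4p1:
  fixes \<Phi> :: "complex \<Rightarrow> complex"
    and s N m :: nat
    and w :: "nat \<Rightarrow> complex"
    and M :: "nat \<Rightarrow> nat"
    and v :: "nat \<Rightarrow> nat \<Rightarrow> complex"
  assumes entire: "\<Phi> holomorphic_on UNIV"
    and nonzero: "\<exists>z. \<Phi> z \<noteq> 0"
    and zero: "\<Phi> 0 = 0"
    and s: "s \<ge> 1"
    and m: "m \<le> 2 * s + 1"
  shows "\<forall>\<^sub>\<approx>u\<in>UNIV. normalized_row_fun \<Phi> s N w M v m u =
                    normalized_row_fun \<Phi> s N w M v (2 * s + 1 - m) u"
proof -
  obtain z where z: "\<Phi> z \<noteq> 0"
    using nonzero by blast
  note nz = entire_shift_nonzero_cosparse[OF entire z]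
  have "\<forall>\<^sub>\<approx>u\<in>UNIV. ext_Q \<Phi> s N w M v a (u + of_int k) \<noteq> 0" for a k
  proof -
    \<comment> \<open>Each \<open>ext_Q\<close> is a finite product of shifts of
      \<open>\<Phi>\<close>; finitely many closed discrete exceptional sets may be discarded
      together.\<close>
    have "\<forall>\<^sub>\<approx>u\<in>UNIV. \<forall>j\<in>{1..N}. \<Phi> (u + (of_int k - w j)) \<noteq> 0"
      by (intro eventually_ball_finite ballI nz) auto
    moreover have "\<forall>\<^sub>\<approx>u\<in>UNIV. \<forall>a\<in>{..2 * s + 1}. \<forall>j\<in>{1..M a}. \<Phi> (u + (of_int k - v a j)) \<noteq> 0"
      by (intro eventually_ball_finite ballI nz) auto
    ultimately show ?thesis
      by eventually_elim (auto simp: ext_Q_def phi_def Qfun_def add_diff_eq)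
  qed
  hence "\<forall>\<^sub>\<approx>u\<in>UNIV. \<forall>a\<in>{..2 * s + 1}. \<forall>k\<in>{- (8 * int s + 8)..8 * int s + 8}.
      ext_Q \<Phi> s N w M v a (u + of_int k) \<noteq> 0"
    by (intro eventually_ball_finite ballI) auto
  thus ?thesis
    by eventually_elim (rule normalized_row_fun_duality[OF s m], auto simp: abs_le_iff)
qed

end
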